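(* Let $W$ be a $d$-dimensional world with $d \ge 2$, let $a_3,\dots,a_d$ be positive integers, and let $B$ be the biray $B = \{ l_W^{-1}(m,n,a_3,\dots,a_d) : m,n \ge 0,\ (m,n)\neq(0,0)\}$. Then the completion sequence of $B$ is additively periodic; equivalently, there exist constants $N_B \ge 0$ and $\pi_B \ge 1$ such that for all integers $m,n > N_B$, the position $l_W^{-1}(m,n,a_3,\dots,a_d)$ is a $\mathcal{P}$-position if and only if $l_W^{-1}(m+\pi_B,n+\pi_B,a_3,\dots,a_d)$ is a $\mathcal{P}$-position.
   Context: Tree nim: a position is a finite tree, possibly empty, whose vertices carry positive integer sizes; a leaf is a vertex of degree at most $1$; a move chooses a leaf and decreases its size by a positive integer, deleting the vertex if its size becomes $0$; normal play (the player unable to move loses). A position is $\mathcal{P}$ iff no move leads to a $\mathcal{P}$-position. World: fix a finite tree $T$ with $d$ leaves ordered $l_1,\dots,l_d$ and fix positive sizes for its non-leaf vertices. The world $W$ consists of the positions with underlying tree $T$, these non-leaf sizes and arbitrary positive leaf sizes, together with all positions reachable from these in one move. The lattice map $l_W$ sends a position of $W$ to the tuple of sizes of $l_1,\dots,l_d$ (with $0$ for a deleted leaf); it is a bijection from $W$ onto $\{(n_1,\dots,n_d)\in\mathbb{N}_0^d : n_i=0 \text{ for at most one } i\}$; $d$ is the dimension. For the biray $B$, $B_b$ denotes the ray $(r_m)_{m\ge0}$ with $l_W(r_m)=(m,b,a_3,\dots,a_d)$; each such ray contains exactly one $\mathcal{P}$-position $r_m$, and $\mathcal{P}(B_b)$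 denotes that $m$. The completion sequence of $B$ is $(\mathcal{P}(B_n))_{n\ge1}$. *)

theory Defs
  imports "Graph_Theory.Digraph_Component"
begin

section \<open>Trees\<close>

text \<open>
  An undirected simple graph is a symmetric, loop-free \<open>pair_graph\<close>.  The library notions
  \<open>forest\<close> and \<open>tree\<close> are meant for digraphs: in a symmetric digraph every edge \<open>{u,v}\<close>
  gives the directed cycle \<open>[(u,v),(v,u)]\<close>.  Cycles of an undirected graph are the directed
  cycles of length at least 3.
\<close>

definition tree_graph :: "'a pair_pre_digraph \<Rightarrow> bool" where
  "tree_graph G \<longleftrightarrow> pair_graph G \<and> connected (with_proj G) \<and>
     \<not> (\<exists>p. pre_digraph.cycle (with_proj G) p \<and> 3 \<le> length p)"

text \<open>In a symmetric graph the out-degree is the degree.\<close>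

definition leaves :: "'a pair_pre_digraph \<Rightarrow> 'a set" where
  "leaves G = {v \<in> pverts G. out_degree (with_proj G) v \<le> 1}"

definition del_vertex :: "'a pair_pre_digraph \<Rightarrow> 'a \<Rightarrow> 'a pair_pre_digraph" where
  "del_vertex G v = \<lparr>pverts = pverts G - {v}, parcs = {e \<in> parcs G. fst e \<noteq> v \<and> snd e \<noteq> v}\<rparr>"


section \<open>Tree nim\<close>

text \<open>The size function is normalised to be 0 outside the vertex set.\<close>

type_synonym 'a position = "'a pair_pre_digraph \<times> ('a \<Rightarrow> nat)"

definition position :: "'a position \<Rightarrow> bool" where
  "position p \<longleftrightarrow> (case p of (G, s) \<Rightarrow>
     (tree_graph G \<or> G = \<lparr>pverts = {}, parcs = {}\<rparr>) \<and>
     (\<forall>v\<in>pverts G. 0 < s v) \<and> (\<forall>v. v \<notin> pverts G \<longrightarrow> s v = 0))"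

definition moves :: "'a position \<Rightarrow> 'a position set" where
  "moves p = (case p of (G, s) \<Rightarrow>
     {q. position (G, s) \<and>
         (\<exists>v\<in>leaves G. \<exists>k. 0 < k \<and> k \<le> s v \<and>
            q = (if k < s v then G else del_vertex G v, s(v := s v - k)))})"

lemma position_finite: "position (G, s) \<Longrightarrow> finite (pverts G)"
  by (auto simp: position_def tree_graph_def pair_graph_def pair_digraph_def pair_fin_digraph_def
      pair_fin_digraph_axioms_def)

lemma moves_less:
  assumes "q \<in> moves p"
  shows "sum (snd q) (pverts (fst q)) < sum (snd p) (pverts (fst p))"
proof -
  obtain G s where p: "p = (G, s)" by (cases p)
  from assms obtain v k where pos: "position (G, s)" and v: "v \<in> leaves G"
    and k: "0 < k" "k \<le> s v"
    and q: "q = (if k < s v then G else del_vertex G v, s(v := s v - k))"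
    by (auto simp: moves_def p)
  have fin: "finite (pverts G)" and vG: "v \<in> pverts G"
    using position_finite[OF pos] v by (auto simp: leaves_def)
  have sub: "pverts (fst q) \<subseteq> pverts G" by (auto simp: q del_vertex_def)
  have "sum (snd q) (pverts (fst q)) \<le> sum (snd q) (pverts G)"
    using fin sub by (intro sum_mono2) auto
  also have "\<dots> < sum s (pverts G)"
    using fin vG k by (intro sum_strict_mono_ex1) (auto simp: q)
  finally show ?thesis by (simp add: p)
qed

function P_position :: "'a position \<Rightarrow> bool" where
  "P_position p \<longleftrightarrow> (\<forall>q\<in>moves p. \<not> P_position q)"
  by pat_completeness auto
termination
  by (relation "measure (\<lambda>p. sum (snd p) (pverts (fst p)))") (auto dest: moves_less)

declare P_position.simps [simp del]


section \<open>Worlds and the lattice map\<close>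

text \<open>
  \<open>c\<close> prescribes the sizes of the non-leaf vertices of \<open>T\<close>; its other values are irrelevant.
\<close>

definition world_base :: "'a pair_pre_digraph \<Rightarrow> ('a \<Rightarrow> nat) \<Rightarrow> 'a position set" where
  "world_base T c = {(T, s) | s. position (T, s) \<and> (\<forall>v\<in>pverts T - leaves T. s v = c v)}"

definition world :: "'a pair_pre_digraph \<Rightarrow> ('a \<Rightarrow> nat) \<Rightarrow> 'a position set" where
  "world T c = world_base T c \<union> (\<Union>p\<in>world_base T c. moves p)"

text \<open>The list \<open>ls\<close> is the ordering of the leaves of \<open>T\<close>; deleted leaves have size 0.\<close>

definition lattice_map :: "'a list \<Rightarrow> 'a position \<Rightarrow> nat list" where
  "lattice_map ls p = map (snd p) ls"

definition lattice_inv ::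
    "'a pair_pre_digraph \<Rightarrow> ('a \<Rightarrow> nat) \<Rightarrow> 'a list \<Rightarrow> nat list \<Rightarrow> 'a position" where
  "lattice_inv T c ls = the_inv_into (world T c) (lattice_map ls)"

text \<open>
  A biray is given as the family of its positions, \<open>B m n\<close> being the position with lattice
  point \<open>(m, n, a\<^sub>3, \<dots>, a\<^sub>d)\<close>; it is only meaningful for \<open>(m, n) \<noteq> (0, 0)\<close>.
\<close>

definition biray ::
    "'a pair_pre_digraph \<Rightarrow> ('a \<Rightarrow> nat) \<Rightarrow> 'a list \<Rightarrow> nat list \<Rightarrow> nat \<Rightarrow> nat \<Rightarrow> 'a position" where
  "biray T c ls a m n = lattice_inv T c ls (m # n # a)"

text \<open>The values at arguments \<open>n \<ge> 1\<close> form the completion sequence.\<close>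

definition completion_seq :: "(nat \<Rightarrow> nat \<Rightarrow> 'a position) \<Rightarrow> nat \<Rightarrow> nat" where
  "completion_seq B n = (THE m. P_position (B m n))"

definition additively_periodic :: "(nat \<Rightarrow> nat) \<Rightarrow> bool" where
  "additively_periodic f \<longleftrightarrow> (\<exists>N p. 1 \<le> p \<and> (\<forall>n>N. f (n + p) = f n + p))"


section \<open>Well-definedness\<close>

lemma with_proj_del_vertex:
  "with_proj (del_vertex G v) = pre_digraph.del_vert (with_proj G) v"
  by (simp add: with_proj_def del_vertex_def pre_digraph.del_vert_def)

lemma pair_graph_del_vertex:
  assumes "pair_graph G" shows "pair_graph (del_vertex G v)"
proof -
  interpret pair_graph G by fact
  have sym: "symmetric (with_proj (del_vertex G v))"
    using pair_sym_arcs by (auto simp: symmetric_def sym_def del_vertex_def)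
  show ?thesis
    by unfold_locales
      (use sym in \<open>auto simp: del_vertex_def arc_fst_in_verts arc_snd_in_verts dest: pair_no_loops\<close>)
qed

lemma connected_pair_graph_iff:
  assumes "pair_graph G"
  shows "connected (with_proj G) \<longleftrightarrow>
    pverts G \<noteq> {} \<and> (\<forall>u\<in>pverts G. \<forall>v\<in>pverts G. (u, v) \<in> rtrancl_on (pverts G) (parcs G))"
proof -
  interpret pair_graph G by fact
  have "mk_symmetric (with_proj G) = G"
    using pair_sym_arcs by (auto simp: mk_symmetric_def symmetric_def sym_def
        intro!: pair_pre_digraph.equality)
  then show ?thesis
    by (simp add: connected_def strongly_connected_def reachable_def)
qed

lemma leaf_unique_neighbour:
  assumes "pair_graph G" "v \<in> leaves G" "(v, x) \<in> parcs G" "(v, y) \<in> parcs G"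
  shows "x = y"
proof -
  interpret pair_graph G by fact
  have "card (out_arcs (with_proj G) v) \<le> 1" using assms by (simp add: leaves_def out_degree_def)
  moreover have "finite (out_arcs (with_proj G) v)"
    by (rule finite_subset[OF _ pair_finite_arcs]) (auto simp: out_arcs_def)
  moreover have "(v, x) \<in> out_arcs (with_proj G) v" "(v, y) \<in> out_arcs (with_proj G) v"
    using assms by (auto simp: out_arcs_def)
  ultimately show ?thesis using card_le_Suc0_iff_eq by fastforce
qed

lemma tree_graph_del_leaf:
  assumes "tree_graph G" "v \<in> leaves G"
  shows "tree_graph (del_vertex G v) \<or> del_vertex G v = \<lparr>pverts = {}, parcs = {}\<rparr>"
proof (cases "pverts G = {v}")
  case True
  interpret pair_graph G using assms by (simp add: tree_graph_def)
  have "parcs (del_vertex G v) = {}"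
    using True arc_fst_in_verts by (force simp: del_vertex_def)
  with True show ?thesis by (simp add: del_vertex_def)
next
  case False
  let ?H = "del_vertex G v"
  have pg: "pair_graph G" and con: "connected (with_proj G)"
    using assms by (auto simp: tree_graph_def)
  interpret pair_graph G by (rule pg)
  have pgH: "pair_graph ?H" by (rule pair_graph_del_vertex[OF pg])
  have vG: "v \<in> pverts G" using assms by (simp add: leaves_def)
  have symm: "(y, x) \<in> parcs G" if "(x, y) \<in> parcs G" for x y
    using pair_sym_arcs that by (auto simp: symmetric_def sym_def)
  have key: "(y \<noteq> v \<longrightarrow> (x, y) \<in> rtrancl_on (pverts ?H) (parcs ?H)) \<and>
      (y = v \<longrightarrow> (\<forall>z. (v, z) \<in> parcs G \<longrightarrow> (x, z) \<in> rtrancl_on (pverts ?H) (parcs ?H)))"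
    if "(x, y) \<in> rtrancl_on (pverts G) (parcs G)" "x \<noteq> v" for x y
    using that
  proof (induction rule: rtrancl_on_induct)
    case base
    then show ?case by (auto simp: del_vertex_def)
  next
    case (step y z)
    have yz: "y \<noteq> z" using pair_no_loops[OF step(2)] by auto
    consider "z = v" | "z \<noteq> v" "y = v" | "z \<noteq> v" "y \<noteq> v" by blast
    then show ?case
    proof cases
      case 1
      have "w = y" if "(v, w) \<in> parcs G" for w
        using leaf_unique_neighbour[OF pg assms(2) that] symm[OF step(2)] 1 by auto
      with step 1 yz show ?thesis by auto
    next
      case 2
      with step show ?thesis by auto
    next
      case 3
      then have "(x, y) \<in> rtrancl_on (pverts ?H) (parcs ?H)" using step by auto
      moreover have "(y, z) \<in> parcs ?H" "z \<in> pverts ?H"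
        using 3 step by (auto simp: del_vertex_def)
      ultimately show ?thesis using 3 by (auto intro: rtrancl_on_into_rtrancl_on)
    qed
  qed
  have "pverts ?H \<noteq> {}" using False vG by (auto simp: del_vertex_def)
  moreover have "(x, y) \<in> rtrancl_on (pverts ?H) (parcs ?H)"
    if "x \<in> pverts ?H" "y \<in> pverts ?H" for x y
    using key[of x y] that con[unfolded connected_pair_graph_iff[OF pg]]
    by (auto simp: del_vertex_def)
  ultimately have "connected (with_proj ?H)" by (simp add: connected_pair_graph_iff[OF pgH])
  moreover have "\<not> (\<exists>p. pre_digraph.cycle (with_proj ?H) p \<and> 3 \<le> length p)"
    using assms subgraph_cycle[OF subgraph_del_vert]
    by (auto simp: tree_graph_def with_proj_del_vertex)
  ultimately show ?thesis using pgH by (simp add: tree_graph_def)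
qed

lemma moves_position:
  assumes "q \<in> moves p" shows "position q"
proof -
  obtain G s where p: "p = (G, s)" by (cases p)
  from assms obtain v k where pos: "position (G, s)" and v: "v \<in> leaves G"
    and k: "0 < k" "k \<le> s v"
    and q: "q = (if k < s v then G else del_vertex G v, s(v := s v - k))"
    by (auto simp: moves_def p)
  have vG: "v \<in> pverts G" using v by (simp add: leaves_def)
  then have "tree_graph G" using pos by (auto simp: position_def)
  then show ?thesis
    using tree_graph_del_leaf[OF _ v] pos vG k
    by (cases "k < s v") (auto simp: position_def q, auto simp: del_vertex_def)
qed

lemma world_iff:
  assumes T: "tree_graph T"
  shows "p \<in> world T c \<longleftrightarrow>
     (\<forall>v\<in>pverts T - leaves T. snd p v = c v \<and> 0 < c v) \<and>
     (\<forall>v. v \<notin> pverts T \<longrightarrow> snd p v = 0) \<and>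
     (fst p = T \<and> (\<forall>v\<in>leaves T. 0 < snd p v) \<or>
      (\<exists>l\<in>leaves T. fst p = del_vertex T l \<and> snd p l = 0 \<and>
         (\<forall>v\<in>leaves T - {l}. 0 < snd p v)))" (is "_ \<longleftrightarrow> ?R")
proof
  have base: "(G, s) \<in> world_base T c \<longleftrightarrow> G = T \<and>
      (\<forall>v\<in>pverts T - leaves T. s v = c v \<and> 0 < c v) \<and>
      (\<forall>v. v \<notin> pverts T \<longrightarrow> s v = 0) \<and> (\<forall>v\<in>leaves T. 0 < s v)" for G s
  proof -
    have "(\<forall>v\<in>pverts T. 0 < s v) \<longleftrightarrow>
        (\<forall>v\<in>pverts T - leaves T. 0 < s v) \<and> (\<forall>v\<in>leaves T. 0 < s v)"
      by (auto simp: leaves_def)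
    moreover have "position (T, s) \<longleftrightarrow>
        (\<forall>v\<in>pverts T. 0 < s v) \<and> (\<forall>v. v \<notin> pverts T \<longrightarrow> s v = 0)"
      using T by (simp add: position_def)
    moreover have "(G, s) \<in> world_base T c \<longleftrightarrow>
        G = T \<and> position (T, s) \<and> (\<forall>v\<in>pverts T - leaves T. s v = c v)"
      by (auto simp: world_base_def)
    ultimately show ?thesis by (metis (no_types, lifting))
  qed
  obtain G s where p: "p = (G, s)" by (cases p)
  {
    assume "p \<in> world T c"
    then consider "p \<in> world_base T c" | q where "q \<in> world_base T c" "p \<in> moves q"
      by (auto simp: world_def)
    then show ?R
    proof cases
      case 1
      then show ?thesis by (auto simp: p base)
    next
      case 2
      obtain s' where q: "q = (T, s')" using 2(1) by (cases q) (auto simp: base)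
      from 2(2) obtain v k where v: "v \<in> leaves T" and k: "0 < k" "k \<le> s' v"
        and pe: "p = (if k < s' v then T else del_vertex T v, s'(v := s' v - k))"
        by (auto simp: moves_def q)
      have "v \<in> pverts T" using v by (simp add: leaves_def)
      with 2(1) v k show ?thesis
        by (cases "k < s' v") (auto simp: q base pe)
    qed
  next
    assume R: ?R
    show "p \<in> world T c"
    proof (cases "G = T \<and> (\<forall>v\<in>leaves T. 0 < s v)")
      case True
      then have "p \<in> world_base T c" using R by (auto simp: p base)
      then show ?thesis by (simp add: world_def)
    next
      case False
      then obtain l where l: "l \<in> leaves T" "G = del_vertex T l" "s l = 0"
        "\<forall>v\<in>leaves T - {l}. 0 < s v"
        using R by (auto simp: p)
      have lT: "l \<in> pverts T" using l by (simp add: leaves_def)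
      let ?q = "(T, s(l := 1))"
      have b: "?q \<in> world_base T c" using R l lT by (auto simp: p base)
      then have "position ?q" by (auto simp: world_base_def)
      then have "p \<in> moves ?q"
        using l by (auto simp: moves_def p intro!: bexI[of _ l] exI[of _ 1])
      with b show ?thesis by (auto simp: world_def)
    qed
  }
qed

lemma lattice_map_bij:
  assumes T: "tree_graph T" and ls: "distinct ls" "set ls = leaves T"
    and c: "\<forall>v\<in>pverts T - leaves T. 0 < c v"
  shows "bij_betw (lattice_map ls) (world T c)
    {ns. length ns = length ls \<and>
         (\<forall>i<length ns. \<forall>j<length ns. ns ! i = 0 \<longrightarrow> ns ! j = 0 \<longrightarrow> i = j)}"
    (is "bij_betw _ _ ?L")
  unfolding bij_betw_def
proof (intro conjI)
  show "inj_on (lattice_map ls) (world T c)"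
  proof (rule inj_onI)
    fix p q assume p: "p \<in> world T c" and q: "q \<in> world T c"
      and eq: "lattice_map ls p = lattice_map ls q"
    have leaf: "snd p v = snd q v" if "v \<in> leaves T" for v
      using eq that ls by (auto simp: lattice_map_def)
    have "snd p v = snd q v" for v
      using leaf[of v] p q unfolding world_iff[OF T] by (cases "v \<in> pverts T"; cases "v \<in> leaves T") auto
    moreover have "fst p = fst q"
    proof -
      have "(fst p = T \<and> (\<forall>v\<in>leaves T. 0 < snd p v) \<or>
        (\<exists>l\<in>leaves T. fst p = del_vertex T l \<and> snd p l = 0 \<and> (\<forall>v\<in>leaves T - {l}. 0 < snd p v)))"
        "(fst q = T \<and> (\<forall>v\<in>leaves T. 0 < snd p v) \<or>
        (\<exists>l\<in>leaves T. fst q = del_vertex T l \<and> snd p l = 0 \<and> (\<forall>v\<in>leaves T - {l}. 0 < snd p v)))"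
        using p q leaf unfolding world_iff[OF T] by auto
      then show ?thesis
        by (metis Diff_iff empty_iff insert_iff less_numeral_extra(3))
    qed
    ultimately show "p = q" by (simp add: prod_eq_iff fun_eq_iff)
  qed
next
  show "lattice_map ls ` world T c = ?L"
  proof (intro equalityI subsetI)
    fix ns assume "ns \<in> lattice_map ls ` world T c"
    then obtain p where p: "p \<in> world T c" and ns: "ns = map (snd p) ls"
      by (auto simp: lattice_map_def)
    have "i = j" if "i < length ls" "j < length ls" "snd p (ls ! i) = 0" "snd p (ls ! j) = 0" for i j
    proof -
      have "ls ! i \<in> leaves T" "ls ! j \<in> leaves T" using that ls by (metis nth_mem)+
      then have "ls ! i = ls ! j" using p that unfolding world_iff[OF T]
        by (metis Diff_iff empty_iff insert_iff less_numeral_extra(3))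
      with ls that show ?thesis by (simp add: nth_eq_iff_index_eq)
    qed
    then show "ns \<in> ?L" by (auto simp: ns)
  next
    fix ns assume ns: "ns \<in> ?L"
    define s where "s v = (if v \<in> leaves T then the (map_of (zip ls ns) v)
        else if v \<in> pverts T then c v else 0)" for v
    have si: "s (ls ! i) = ns ! i" if "i < length ls" for i
      using that ns ls nth_mem[OF that] by (simp add: s_def map_of_zip_nth)
    have uniq: "i = j" if "i < length ls" "j < length ls" "ns ! i = 0" "ns ! j = 0" for i j
      using ns that by simp
    have map_s: "map s ls = ns" using si ns by (auto intro!: nth_equalityI)
    have s_nonleaf: "s v = c v" if "v \<in> pverts T - leaves T" for v
      using that by (simp add: s_def)
    have s_out: "s v = 0" if "v \<notin> pverts T" for v
      using that by (simp add: s_def leaves_def)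
    have leafD: "\<exists>i<length ls. v = ls ! i" if "v \<in> leaves T" for v
      using that ls by (metis in_set_conv_nth)
    have "\<exists>p\<in>world T c. snd p = s"
    proof (cases "\<exists>l\<in>leaves T. s l = 0")
      case True
      then obtain l where l: "l \<in> leaves T" "s l = 0" by auto
      have pos: "0 < s v" if v: "v \<in> leaves T - {l}" for v
      proof -
        obtain i where i: "i < length ls" "l = ls ! i" using leafD l by blast
        obtain j where j: "j < length ls" "v = ls ! j" using leafD v by blast
        have "i \<noteq> j" using v i j by auto
        moreover have "ns ! i = 0" using l si i by simp
        ultimately have "ns ! j \<noteq> 0" using uniq i(1) j(1) by blast
        then show ?thesis using si j by simp
      qed
      have "(del_vertex T l, s) \<in> world T c"
        unfolding world_iff[OF T] fst_conv snd_conv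
        using s_nonleaf s_out pos l c by blast
      then show ?thesis by force
    next
      case False
      then have "\<forall>v\<in>leaves T. 0 < s v" by simp
      then have "(T, s) \<in> world T c"
        unfolding world_iff[OF T] fst_conv snd_conv
        using s_nonleaf s_out c by blast
      then show ?thesis by force
    qed
    then show "ns \<in> lattice_map ls ` world T c"
      using map_s by (force simp: lattice_map_def)
  qed
qed

end

theory Submission
  imports Defs
begin

text \<open>
  Fix all sizes except those \<open>m\<close>, \<open>n\<close> of two leaves.  For \<open>m, n > 0\<close> the position is \<open>\<P>\<close> iff
  no \<open>\<P>\<close>-position precedes it in its row or column and no move at a third leaf leads to a
  \<open>\<P>\<close>-position.  By induction on the sum of the other sizes, the cells blocked by moves at third
  leaves lie in a band around the diagonal and are eventually invariant under a diagonal
  translation.  Counting shows that the \<open>\<P>\<close>-positions lie in a band as well.  Hence, going through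
  the rows, all that matters is which columns of a window of fixed width around the diagonal are
  already occupied; this state takes finitely many values, so it recurs at two rows that are
  congruent modulo the period of the blocked cells, and from then on everything repeats.
\<close>

section \<open>Diagonally periodic arrays\<close>

text \<open>The axes are left out: there one of the two leaves is deleted and the greedy rule below
  need not hold.\<close>

definition banded :: "nat \<Rightarrow> (nat \<Rightarrow> nat \<Rightarrow> bool) \<Rightarrow> bool" where
  "banded D A \<longleftrightarrow> (\<forall>m n. 0 < m \<longrightarrow> 0 < n \<longrightarrow> A m n \<longrightarrow> m \<le> n + D \<and> n \<le> m + D)"

definition diag_invariant :: "nat \<Rightarrow> nat \<Rightarrow> (nat \<Rightarrow> nat \<Rightarrow> bool) \<Rightarrow> bool" where
  "diag_invariant N p A \<longleftrightarrow> (\<forall>m n. N < m \<longrightarrow> N < n \<longrightarrow> (A m n \<longleftrightarrow> A (m + p) (n + p)))"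

definition diag_periodic :: "(nat \<Rightarrow> nat \<Rightarrow> bool) \<Rightarrow> bool" where
  "diag_periodic A \<longleftrightarrow> (\<exists>D. banded D A) \<and> (\<exists>N p. 1 \<le> p \<and> diag_invariant N p A)"

lemma diag_invariantD:
  "diag_invariant N p A \<Longrightarrow> N < m \<Longrightarrow> N < n \<Longrightarrow> A m n \<longleftrightarrow> A (m + p) (n + p)"
  unfolding diag_invariant_def by blast

lemma diag_invariant_mult:
  assumes "diag_invariant N p A" shows "diag_invariant N (k * p) A"
  using assms
proof (induction k)
  case 0
  show ?case by (simp add: diag_invariant_def)
next
  case (Suc k)
  have "A m n \<longleftrightarrow> A (m + Suc k * p) (n + Suc k * p)" if "N < m" "N < n" for m n
  proof -
    have "A m n \<longleftrightarrow> A (m + k * p) (n + k * p)"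
      by (rule diag_invariantD[OF Suc.IH[OF Suc.prems] that])
    also have "\<dots> \<longleftrightarrow> A (m + k * p + p) (n + k * p + p)"
      using that by (intro diag_invariantD[OF Suc.prems]) auto
    finally show ?thesis by (simp add: ac_simps)
  qed
  then show ?case unfolding diag_invariant_def by blast
qed

text \<open>The sum of the two bands contains both arrays, and the product of the two periods is a
  period of each.\<close>

lemma diag_periodic_disj:
  assumes "diag_periodic A" "diag_periodic B"
  shows "diag_periodic (\<lambda>m n. A m n \<or> B m n)"
proof -
  obtain D N p where A: "banded D A" "1 \<le> p" "diag_invariant N p A"
    using assms(1) unfolding diag_periodic_def by blast
  obtain D' N' p' where B: "banded D' B" "1 \<le> p'" "diag_invariant N' p' B"
    using assms(2) unfolding diag_periodic_def by blast
  have "banded (D + D') (\<lambda>m n. A m n \<or> B m n)"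
    using A(1) B(1) unfolding banded_def by (metis add.assoc add.commute trans_le_add1)
  moreover have "diag_invariant (N + N') (p * p') (\<lambda>m n. A m n \<or> B m n)"
    unfolding diag_invariant_def
  proof (intro allI impI)
    fix m n assume mn: "N + N' < m" "N + N' < n"
    have "A m n \<longleftrightarrow> A (m + p * p') (n + p * p')"
      using diag_invariantD[OF diag_invariant_mult[OF A(3), of p'], of m n] mn
      by (simp add: mult.commute)
    moreover have "B m n \<longleftrightarrow> B (m + p * p') (n + p * p')"
      using diag_invariantD[OF diag_invariant_mult[OF B(3), of p], of m n] mn by simp
    ultimately show "A m n \<or> B m n \<longleftrightarrow> A (m + p * p') (n + p * p') \<or> B (m + p * p') (n + p * p')"
      by blast
  qed
  moreover have "1 \<le> p * p'" using A B by (simp add: Suc_le_eq)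
  ultimately show ?thesis unfolding diag_periodic_def by blast
qed

lemma diag_periodic_Bex:
  assumes "finite I" "\<And>i. i \<in> I \<Longrightarrow> diag_periodic (A i)"
  shows "diag_periodic (\<lambda>m n. \<exists>i\<in>I. A i m n)"
  using assms
proof (induction I rule: finite_induct)
  case empty
  show ?case by (auto simp: diag_periodic_def banded_def diag_invariant_def)
next
  case (insert i I)
  then show ?case using diag_periodic_disj[of "A i" "\<lambda>m n. \<exists>i\<in>I. A i m n"] by simp
qed


section \<open>Greedy arrays\<close>

text \<open>\<open>A\<close> models the \<P>-positions and \<open>F\<close> the cells excluded by
  moves at third leaves. The rule is asked only off the axes; \<open>M\<close> bounds the cells on
  the axes, which act as initial data.\<close>

locale greedy_array =
  fixes A F :: "nat \<Rightarrow> nat \<Rightarrow> bool" and D M :: nat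
  assumes A_iff: "\<And>m n. 0 < m \<Longrightarrow> 0 < n \<Longrightarrow>
      A m n \<longleftrightarrow> \<not> F m n \<and> (\<forall>m'<m. \<not> A m' n) \<and> (\<forall>n'<n. \<not> A m n')"
    and F_banded: "banded D F"
    and row_0: "\<And>m. M < m \<Longrightarrow> \<not> A m 0"
    and col_0: "\<And>n. M < n \<Longrightarrow> \<not> A 0 n"
begin

text \<open>The greedy rule is symmetric, so every fact about rows yields one about columns.\<close>

lemma transpose: "greedy_array (\<lambda>m n. A n m) (\<lambda>m n. F n m) D M"
  using A_iff F_banded row_0 col_0 by unfold_locales (auto simp: banded_def)

section \<open>One cell in each row and column, close to the diagonal\<close>

lemma row_unique: "A m n \<Longrightarrow> A m' n \<Longrightarrow> 0 < n \<Longrightarrow> m = m'"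
  using A_iff by (metis linorder_neqE_nat not_less_zero gr0I)

lemma col_unique: "A m n \<Longrightarrow> A m n' \<Longrightarrow> 0 < m \<Longrightarrow> n = n'"
  using greedy_array.row_unique[OF transpose] by blast

definition width :: nat where "width = M + 2 * D + 1"

text \<open>Pigeonhole: if row \<open>n\<close> had no cell up to \<open>n + width\<close>, each of
  the \<open>n + 2 * D + 1\<close> columns in \<open>I\<close> would be excluded by \<open>F\<close>
  (at most \<open>2 * D + 1\<close> columns) or by a cell in one of the rows \<open>1\<close>, ...,
  \<open>n - 1\<close>, which hold at most one cell each.\<close>

lemma row_exists:
  assumes n: "0 < n" shows "\<exists>m\<le>n + width. A m n"
proof (rule ccontr)
  assume none: "\<not> ?thesis"
  define I where "I = {M<..n + width}"
  define J where "J = {m \<in> I. \<exists>n'<n. A m n'}"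
  have IJ: "I \<subseteq> {n - D..n + D} \<union> J"
  proof
    fix m assume m: "m \<in> I"
    then have "\<not> A m n" "\<forall>m'<m. \<not> A m' n" "0 < m"
      using none by (auto simp: I_def)
    then have "F m n \<or> (\<exists>n'<n. A m n')" using A_iff n by blast
    then show "m \<in> {n - D..n + D} \<union> J"
    proof
      assume "F m n"
      then have "m \<le> n + D \<and> n \<le> m + D" using F_banded n \<open>0 < m\<close> by (simp add: banded_def)
      then show ?thesis by auto
    qed (use m in \<open>auto simp: J_def\<close>)
  qed
  have "\<forall>m\<in>J. \<exists>n'. n' < n \<and> A m n'" by (auto simp: J_def)
  then obtain g where g: "\<And>m. m \<in> J \<Longrightarrow> g m < n \<and> A m (g m)" by metis
  \<comment> \<open>Columns in \<open>I\<close> exceed \<open>M\<close>, so row 0 excludes none of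
    them; this leaves only \<open>n - 1\<close> rows for the count.\<close>
  have g0: "0 < g m" if "m \<in> J" for m
    using g[OF that] that row_0[of m] by (cases "g m") (auto simp: J_def I_def)
  have "inj_on g J" using g g0 row_unique by (metis inj_onI)
  moreover have "g ` J \<subseteq> {0<..<n}" using g g0 by auto
  ultimately have "card J \<le> card {0<..<n}" by (metis card_inj_on_le finite_greaterThanLessThan)
  moreover have "finite J" by (simp add: J_def I_def)
  then have "card I \<le> card ({n - D..n + D} \<union> J)" using IJ by (intro card_mono) auto
  moreover have "card ({n - D..n + D} \<union> J) \<le> card {n - D..n + D} + card J" by (rule card_Un_le)
  ultimately show False using n by (simp add: I_def width_def)
qed

lemma col_exists: "0 < m \<Longrightarrow> \<exists>n\<le>m + width. A m n"
  by (rule greedy_array.row_exists[OF transpose])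

text \<open>Existence bounds the cell of a row only from above. The other half of the band is the
  corresponding bound for its column; uniqueness identifies the cells.\<close>

lemma A_banded: "banded width A"
  unfolding banded_def
proof (intro allI impI)
  fix m n assume mn: "0 < m" "0 < n" "A m n"
  obtain m' where m': "m' \<le> n + width" "A m' n" using row_exists mn(2) by blast
  obtain n' where n': "n' \<le> m + width" "A m n'" using col_exists mn(1) by blast
  show "m \<le> n + width \<and> n \<le> m + width"
    using m' n' row_unique[OF mn(3) m'(2) mn(2)] col_unique[OF mn(3) n'(2) mn(1)] by simp
qed

section \<open>Occupied columns as a finite state passed from row to row\<close>

definition used :: "nat \<Rightarrow> nat \<Rightarrow> bool" where
  "used n m \<longleftrightarrow> (\<exists>n'<n. A m n')"

lemma used_Suc: "used (Suc n) m \<longleftrightarrow> used n m \<or> A m n"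
  by (auto simp: used_def less_Suc_eq)

lemma used_left: "0 < m \<Longrightarrow> m + width < n \<Longrightarrow> used n m"
  using col_exists[of m] unfolding used_def by (meson le_less_trans)

lemma not_used_right:
  assumes "n + width < m" shows "\<not> used n m"
proof
  assume "used n m"
  then obtain n' where n': "n' < n" "A m n'" by (auto simp: used_def)
  show False
  proof (cases "n' = 0")
    case True
    then show False using n' row_0[of m] assms by (simp add: width_def)
  next
    case False
    then have "m \<le> n' + width" using n' A_banded assms by (simp add: banded_def)
    then show False using n'(1) assms by simp
  qed
qed

lemma A_used_iff:
  "0 < m \<Longrightarrow> 0 < n \<Longrightarrow> A m n \<longleftrightarrow> \<not> F m n \<and> \<not> used n m \<and> (\<forall>m'<m. \<not> A m' n)"
  using A_iff by (auto simp: used_def)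

text \<open>Such a column already has its only cell in a row before \<open>n0\<close>; column 0 is
  covered by \<open>col_0\<close> instead.\<close>

lemma not_A_left:
  assumes "n0 \<le> n" "M + width < n0" "m + width < n0" shows "\<not> A m n"
proof (cases "m = 0")
  case True
  then show ?thesis using col_0 assms by simp
next
  case False
  then obtain n' where "n' < n0" "A m n'"
    using used_left[of m n0] assms(3) by (auto simp: used_def)
  then show ?thesis using False assms(1) col_unique[of m n n'] by auto
qed

text \<open>At row \<open>n0\<close>, positive columns left of the window are all used and columns
  right of it are all free. Equal states in the window therefore make the greedy construction
  continue identically from rows \<open>n0\<close> and \<open>n0 + q\<close>.\<close>

lemma A_diag_invariant:
  assumes F: "diag_invariant N q F"
    and n0: "N + M + 2 * width < n0"
    and state: "\<And>i. i \<le> 2 * width \<Longrightarrow> used n0 (n0 - width + i) \<longleftrightarrow> used (n0 + q) (n0 + q - width + i)"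
  shows "diag_invariant n0 q A"
proof -
  define t where "t = n0 - width"
  have t: "N < t" "0 < t" using n0 by (auto simp: t_def)
  \<comment> \<open>One row is filled from left to right: if its used columns agree with the shifted
    ones, so do its cells. Columns before \<open>t\<close> contribute nothing from row
    \<open>n0\<close> on.\<close>
  have A_shift: "A m n \<longleftrightarrow> A (m + q) (n + q)"
    if n: "n0 \<le> n" and used: "\<And>m. t \<le> m \<Longrightarrow> used n m \<longleftrightarrow> used (n + q) (m + q)" and "t \<le> m" for m n
    using \<open>t \<le> m\<close>
  proof (induction m rule: less_induct)
    case (less m)
    have "(\<forall>m'<m. \<not> A m' n) \<longleftrightarrow> (\<forall>m'<m + q. \<not> A m' (n + q))" (is "?L \<longleftrightarrow> ?R")
    proof
      assume L: ?L
      show ?R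
      proof (intro allI impI)
        fix m' assume m': "m' < m + q"
        show "\<not> A m' (n + q)"
        proof (cases "t + q \<le> m'")
          case True
          then have "t \<le> m' - q" "m' - q < m" "m' - q + q = m'" using m' by auto
          then show ?thesis using less.IH[of "m' - q"] L by simp
        next
          case False
          then show ?thesis using n n0 by (intro not_A_left[of "n0 + q"]) (auto simp: t_def)
        qed
      qed
    next
      assume R: ?R
      show ?L
      proof (intro allI impI)
        fix m' assume m': "m' < m"
        show "\<not> A m' n"
        proof (cases "t \<le> m'")
          case True
          then show ?thesis using less.IH[of m'] R m' by simp
        next
          case False
          then show ?thesis using n n0 by (intro not_A_left[of n0]) (auto simp: t_def)
        qed
      qed
    qed
    moreover have "F m n \<longleftrightarrow> F (m + q) (n + q)"
      using t less.prems n n0 by (intro diag_invariantD[OF F]) auto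
    ultimately show ?case
      using A_used_iff[of m n] A_used_iff[of "m + q" "n + q"] used[OF less.prems] t less.prems n n0
      by simp
  qed
  \<comment> \<open>Induction over the rows; \<open>A_shift\<close> carries the agreement from one
    row to the next.\<close>
  have used_shift: "used n m \<longleftrightarrow> used (n + q) (m + q)" if "n0 \<le> n" "t \<le> m" for m n
    using that
  proof (induction n arbitrary: m rule: dec_induct)
    case base
    show ?case
    proof (cases "m \<le> n0 + width")
      case True
      define i where "i = m - t"
      have "i \<le> 2 * width" "n0 - width + i = m" "n0 + q - width + i = m + q"
        using True base n0 by (auto simp: i_def t_def)
      then show ?thesis using state[of i] by simp
    next
      case False
      then show ?thesis using not_used_right by simp
    qed
  next
    case (step n)
    then show ?case using A_shift[of n m] by (simp add: used_Suc)
  qed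
  show ?thesis
    unfolding diag_invariant_def
  proof (intro allI impI)
    fix m n assume "n0 < m" "n0 < n"
    then show "A m n \<longleftrightarrow> A (m + q) (n + q)"
      by (intro A_shift used_shift) (auto simp: t_def)
  qed
qed

text \<open>A window has finitely many states, so two of the sampled rows have the same one.\<close>

lemma A_diag_periodic:
  assumes "diag_periodic F" shows "diag_periodic A"
proof -
  obtain N p where p: "1 \<le> p" and F: "diag_invariant N p F"
    using assms by (auto simp: diag_periodic_def)
  \<comment> \<open>Sampling every \<open>p\<close> rows makes the distance of any two samples a
    multiple of \<open>p\<close>, hence a period of \<open>F\<close>; the offset meets the bound
    required by \<open>A_diag_invariant\<close>.\<close>
  define h where "h k = N + M + 2 * width + 1 + k * p" for k
  define st where "st k = {i. i \<le> 2 * width \<and> used (h k) (h k - width + i)}" for k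
  have "range st \<subseteq> Pow {..2 * width}" by (auto simp: st_def)
  then have "finite (range st)" by (rule finite_subset) simp
  then have "\<not> inj st" using finite_imageD infinite_UNIV_nat by blast
  then obtain k l where kl: "k < l" "st k = st l"
    unfolding inj_on_def by (metis linorder_neqE_nat)
  have hl: "h l = h k + (l - k) * p"
    using kl by (simp add: h_def flip: add_mult_distrib)
  have "diag_invariant (h k) ((l - k) * p) A"
  proof (rule A_diag_invariant)
    show "diag_invariant N ((l - k) * p) F" by (rule diag_invariant_mult[OF F])
    show "N + M + 2 * width < h k" by (simp add: h_def)
    show "used (h k) (h k - width + i) \<longleftrightarrow>
        used (h k + (l - k) * p) (h k + (l - k) * p - width + i)" if "i \<le> 2 * width" for i
    proof -
      have "i \<in> st k \<longleftrightarrow> i \<in> st l" using kl(2) by simp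
      then show ?thesis using that by (simp only: st_def mem_Collect_eq hl[symmetric] simp_thms)
    qed
  qed
  moreover have "1 \<le> (l - k) * p" using kl p by simp
  ultimately show ?thesis
    unfolding diag_periodic_def by (intro conjI exI) (rule A_banded)
qed

lemma additively_periodic_The:
  assumes "diag_invariant N p A" "1 \<le> p"
  shows "additively_periodic (\<lambda>n. THE m. A m n)"
proof -
  \<comment> \<open>Beyond \<open>M\<close> the cell of row \<open>n\<close> is not in column 0;
    then the band forces its column beyond \<open>N\<close>, where invariance applies.\<close>
  have "(THE m. A m (n + p)) = (THE m. A m n) + p" if n: "N + M + width < n" for n
  proof -
    obtain m where m: "A m n" using row_exists[of n] n by auto
    have "0 < m" using m col_0[of n] n by (cases m) auto
    then have "n \<le> m + width" using A_banded m n by (simp add: banded_def)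
    then have "N < m" using n by simp
    then have "A (m + p) (n + p)" using diag_invariantD[OF assms(1), of m n] m n by simp
    moreover have The: "(THE m. A m n) = m" if "A m n" "0 < n" for m n
      using that(1) by (rule the_equality) (rule row_unique[OF _ that])
    ultimately have "(THE m. A m (n + p)) = m + p" using n by simp
    moreover have "(THE m. A m n) = m" using The[OF m] n by simp
    ultimately show ?thesis by simp
  qed
  then show ?thesis using assms(2) unfolding additively_periodic_def by blast
qed

end


section \<open>Two varying leaves\<close>

text \<open>Deleting a vertex cannot raise a degree. Thus both chosen leaves stay leaves after any
  move at a third leaf.\<close>

lemma leaves_del_vertex:
  assumes "position (G, s)" "x \<in> leaves G" "x \<noteq> v"
  shows "x \<in> leaves (del_vertex G v)"
proof -
  have "pair_graph G" using assms by (auto simp: position_def leaves_def tree_graph_def)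
  then interpret pair_graph G .
  have "out_arcs (with_proj (del_vertex G v)) x \<subseteq> out_arcs (with_proj G) x"
    by (auto simp: out_arcs_def del_vertex_def)
  moreover have "finite (out_arcs (with_proj G) x)"
    by (rule finite_subset[OF _ pair_finite_arcs]) (auto simp: out_arcs_def)
  ultimately have "out_degree (with_proj (del_vertex G v)) x \<le> out_degree (with_proj G) x"
    unfolding out_degree_def by (rule card_mono[rotated])
  then show ?thesis using assms by (auto simp: leaves_def del_vertex_def)
qed

section \<open>Moves by new leaf size, and the plane of two leaves\<close>

definition reduce :: "'a pair_pre_digraph \<Rightarrow> ('a \<Rightarrow> nat) \<Rightarrow> 'a \<Rightarrow> nat \<Rightarrow> 'a position" where
  "reduce G s v j = (if 0 < j then G else del_vertex G v, s(v := j))"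

lemma moves_eq_reduce:
  assumes "position (G, s)"
  shows "moves (G, s) = (\<Union>v\<in>leaves G. reduce G s v ` {..<s v})"
proof (intro equalityI subsetI)
  fix q assume "q \<in> moves (G, s)"
  then obtain v k where v: "v \<in> leaves G" and k: "0 < k" "k \<le> s v"
    and q: "q = (if k < s v then G else del_vertex G v, s(v := s v - k))"
    by (auto simp: moves_def)
  have "q = reduce G s v (s v - k)" using q by (simp add: reduce_def)
  moreover have "s v - k \<in> {..<s v}" using k by simp
  ultimately show "q \<in> (\<Union>v\<in>leaves G. reduce G s v ` {..<s v})" using v by blast
next
  fix q assume "q \<in> (\<Union>v\<in>leaves G. reduce G s v ` {..<s v})"
  then obtain v j where v: "v \<in> leaves G" and j: "j < s v" and q: "q = reduce G s v j" by auto
  have "q = (if s v - j < s v then G else del_vertex G v, s(v := s v - (s v - j)))"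
    using q j by (auto simp: reduce_def)
  moreover have "0 < s v - j" "s v - j \<le> s v" using j by auto
  ultimately show "q \<in> moves (G, s)" using assms v unfolding moves_def by blast
qed

lemma P_position_reduce:
  assumes "position (G, s)"
  shows "P_position (G, s) \<longleftrightarrow> (\<forall>v\<in>leaves G. \<forall>j<s v. \<not> P_position (reduce G s v j))"
  by (subst P_position.simps) (auto simp: moves_eq_reduce[OF assms])

text \<open>For distinct vertices \<open>x\<close> and \<open>y\<close> of \<open>G\<close> the
  value at (0, 0) is not a position: \<open>y\<close> remains with size 0. It has no moves and so
  counts as \<P>, which is why (0, 0) is avoided below.\<close>

definition plane ::
    "'a pair_pre_digraph \<Rightarrow> ('a \<Rightarrow> nat) \<Rightarrow> 'a \<Rightarrow> 'a \<Rightarrow> nat \<Rightarrow> nat \<Rightarrow> 'a position" where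
  "plane G s x y m n =
     (if m = 0 then del_vertex G x else if n = 0 then del_vertex G y else G, s(x := m, y := n))"

definition blocked ::
    "'a pair_pre_digraph \<Rightarrow> ('a \<Rightarrow> nat) \<Rightarrow> 'a \<Rightarrow> 'a \<Rightarrow> nat \<Rightarrow> nat \<Rightarrow> bool" where
  "blocked G s x y m n \<longleftrightarrow> (\<exists>(v, j)\<in>(SIGMA v:leaves G - {x, y}. {..<s v}).
     P_position (plane (fst (reduce G s v j)) (snd (reduce G s v j)) x y m n))"

lemma P_plane_iff:
  assumes pos: "position (G, s)" and x: "x \<in> leaves G" and y: "y \<in> leaves G" and "x \<noteq> y"
    and m: "0 < m" and n: "0 < n"
  shows "P_position (plane G s x y m n) \<longleftrightarrow> \<not> blocked G s x y m n \<and>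
    (\<forall>m'<m. \<not> P_position (plane G s x y m' n)) \<and> (\<forall>n'<n. \<not> P_position (plane G s x y m n'))"
proof -
  define t where "t = s(x := m, y := n)"
  have xy: "x \<in> pverts G" "y \<in> pverts G" using x y by (auto simp: leaves_def)
  have pt: "position (G, t)" using pos xy m n by (auto simp: position_def t_def)
  have t: "t x = m" "t y = n" using \<open>x \<noteq> y\<close> by (auto simp: t_def)
  \<comment> \<open>A move at a third leaf commutes with setting the sizes of \<open>x\<close> and
    \<open>y\<close>.\<close>
  have others: "t v = s v"
      "reduce G t v j = plane (fst (reduce G s v j)) (snd (reduce G s v j)) x y m n"
    if "v \<in> leaves G - {x, y}" for v j
    using that m n by (auto simp: reduce_def plane_def t_def fun_eq_iff)
  have "plane G s x y m n = (G, t)" using m n by (simp add: plane_def t_def)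
  then have "P_position (plane G s x y m n) \<longleftrightarrow>
      (\<forall>v\<in>leaves G. \<forall>j<t v. \<not> P_position (reduce G t v j))"
    by (simp add: P_position_reduce[OF pt])
  also have "\<dots> \<longleftrightarrow> (\<forall>v\<in>leaves G - {x, y}. \<forall>j<t v. \<not> P_position (reduce G t v j)) \<and>
      (\<forall>j<t x. \<not> P_position (reduce G t x j)) \<and> (\<forall>j<t y. \<not> P_position (reduce G t y j))"
    using x y by blast
  also have "(\<forall>v\<in>leaves G - {x, y}. \<forall>j<t v. \<not> P_position (reduce G t v j)) \<longleftrightarrow>
      \<not> blocked G s x y m n"
    using others unfolding blocked_def by auto
  also have "reduce G t x = (\<lambda>m'. plane G s x y m' n)"
    using n \<open>x \<noteq> y\<close> by (auto simp: reduce_def plane_def t_def fun_eq_iff)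
  also have "reduce G t y = plane G s x y m"
    using m by (auto simp: reduce_def plane_def t_def fun_eq_iff)
  finally show ?thesis by (simp only: t)
qed

section \<open>Cells in which one of the two leaves is deleted\<close>

lemma plane_swap:
  assumes "x \<noteq> y" "(m, n) \<noteq> (0, 0)"
  shows "plane G s y x n m = plane G s x y m n"
  using assms by (auto simp: plane_def fun_upd_twist)

text \<open>After the deletion of \<open>y\<close>, the vertex \<open>x\<close> is still a leaf, so
  its size can be lowered from \<open>m\<close> to \<open>k\<close>.\<close>

lemma plane_row_0_unique:
  assumes pos: "position (G, s)" and x: "x \<in> leaves G" and y: "y \<in> leaves G" and xy: "x \<noteq> y"
    and k: "0 < k" "k < m" and P: "P_position (plane G s x y k 0)"
  shows "\<not> P_position (plane G s x y m 0)"
proof -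
  have "x \<in> pverts G" "y \<in> pverts G" using x y by (auto simp: leaves_def)
  then have p1: "position (G, s(x := m, y := 1))"
    using pos k by (auto simp: position_def)
  have eq: "plane G s x y m 0 = (del_vertex G y, s(x := m, y := 0))"
    using k by (simp add: plane_def)
  \<comment> \<open>Size 1 at \<open>y\<close> is auxiliary: the cell arises by a legal move and
    hence is a position.\<close>
  have "plane G s x y m 0 = reduce G (s(x := m, y := 1)) y 0"
    using k by (simp add: reduce_def plane_def)
  then have "plane G s x y m 0 \<in> moves (G, s(x := m, y := 1))"
    using y unfolding moves_eq_reduce[OF p1] by (force simp del: One_nat_def)
  then have p0: "position (del_vertex G y, s(x := m, y := 0))"
    using moves_position eq by metis
  have r: "reduce (del_vertex G y) (s(x := m, y := 0)) x k = plane G s x y k 0"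
    using k xy by (auto simp: reduce_def plane_def fun_eq_iff)
  have k': "k < (s(x := m, y := 0)) x" using k xy by simp
  show ?thesis
  proof
    assume "P_position (plane G s x y m 0)"
    then have "\<not> P_position (reduce (del_vertex G y) (s(x := m, y := 0)) x k)"
      unfolding eq P_position_reduce[OF p0] using leaves_del_vertex[OF pos x xy] k' by blast
    then show False using P r by simp
  qed
qed

lemma plane_row_0_bounded:
  assumes "position (G, s)" "x \<in> leaves G" "y \<in> leaves G" "x \<noteq> y"
  shows "\<exists>M. \<forall>m>M. \<not> P_position (plane G s x y m 0)"
proof (cases "\<exists>k>0. P_position (plane G s x y k 0)")
  case True
  then show ?thesis using plane_row_0_unique[OF assms] by blast
qed blast

lemma greedy_array_plane:
  assumes pos: "position (G, s)" and x: "x \<in> leaves G" and y: "y \<in> leaves G" and xy: "x \<noteq> y"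
    and D: "banded D (blocked G s x y)"
  obtains M where "greedy_array (\<lambda>m n. P_position (plane G s x y m n)) (blocked G s x y) D M"
proof -
  obtain M1 where M1: "\<forall>m>M1. \<not> P_position (plane G s x y m 0)"
    using plane_row_0_bounded[OF pos x y xy] by blast
  obtain M2 where M2: "\<forall>n>M2. \<not> P_position (plane G s y x n 0)"
    using plane_row_0_bounded[OF pos y x] xy by blast
  \<comment> \<open>The sum of the two axis bounds serves both axes.\<close>
  have "greedy_array (\<lambda>m n. P_position (plane G s x y m n)) (blocked G s x y) D (M1 + M2)"
  proof
    show "\<not> P_position (plane G s x y 0 n)" if "M1 + M2 < n" for n
    proof -
      have "M2 < n" "plane G s y x n 0 = plane G s x y 0 n"
        using that plane_swap[OF xy, of 0 n G s] by auto
      then show ?thesis using M2 by metis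
    qed
  qed (use M1 D P_plane_iff[OF pos x y xy] in auto)
  then show thesis by (rule that)
qed

text \<open>The induction measure counts all vertices except \<open>x\<close> and \<open>y\<close>,
  inner ones included, and \<open>G\<close> varies, so leaves newly exposed by a deletion are
  covered. Periodicity of \<open>blocked\<close> is kept in the conclusion because its band is
  needed again to obtain the greedy array for the final theorem.\<close>

lemma diag_periodic_plane_blocked:
  assumes "position (G, s)" "x \<in> leaves G" "y \<in> leaves G" "x \<noteq> y"
  shows "diag_periodic (\<lambda>m n. P_position (plane G s x y m n)) \<and> diag_periodic (blocked G s x y)"
  using assms
proof (induction "sum s (pverts G - {x, y})" arbitrary: G s rule: less_induct)
  case less
  note pos = less.prems(1) and x = less.prems(2) and y = less.prems(3) and xy = less.prems(4)
  have fin: "finite (pverts G)" by (rule position_finite[OF pos])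
  have fin_leaves: "finite (leaves G)" using fin by (simp add: leaves_def)
  have "diag_periodic (\<lambda>m n. \<exists>vj\<in>(SIGMA v:leaves G - {x, y}. {..<s v}).
      P_position (plane (fst (reduce G s (fst vj) (snd vj)))
        (snd (reduce G s (fst vj) (snd vj))) x y m n))"
  proof (rule diag_periodic_Bex)
    fix vj assume "vj \<in> (SIGMA v:leaves G - {x, y}. {..<s v})"
    then obtain v j where vj: "vj = (v, j)" and v: "v \<in> leaves G" "v \<noteq> x" "v \<noteq> y" and j: "j < s v"
      by auto
    obtain G' s' where r: "reduce G s v j = (G', s')" by fastforce
    have G': "G' = (if 0 < j then G else del_vertex G v)" and s': "s' = s(v := j)"
      using r by (auto simp: reduce_def)
    have "(G', s') \<in> moves (G, s)" using v j r by (force simp: moves_eq_reduce[OF pos])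
    then have pos': "position (G', s')" by (rule moves_position)
    have x': "x \<in> leaves G'" and y': "y \<in> leaves G'"
      using leaves_del_vertex[OF pos] x y v by (auto simp: G')
    have "sum s' (pverts G' - {x, y}) \<le> sum s' (pverts G - {x, y})"
      using fin by (intro sum_mono2) (auto simp: G' del_vertex_def)
    also have "\<dots> < sum s (pverts G - {x, y})"
      using fin v j by (intro sum_strict_mono_ex1) (auto simp: s' leaves_def)
    finally show "diag_periodic (\<lambda>m n. P_position (plane (fst (reduce G s (fst vj) (snd vj)))
        (snd (reduce G s (fst vj) (snd vj))) x y m n))"
      using less.hyps[OF _ pos' x' y' xy] by (simp add: vj r)
  qed (use fin_leaves in auto)
  then have F: "diag_periodic (blocked G s x y)"
    by (simp only: blocked_def[abs_def] case_prod_beta')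
  then obtain D where "banded D (blocked G s x y)" by (auto simp: diag_periodic_def)
  then obtain M where "greedy_array (\<lambda>m n. P_position (plane G s x y m n)) (blocked G s x y) D M"
    by (rule greedy_array_plane[OF pos x y xy])
  then show ?case using F greedy_array.A_diag_periodic by blast
qed


section \<open>Birays\<close>

lemma lattice_inv_eq:
  assumes "tree_graph T" "distinct ls" "set ls = leaves T" "\<forall>v\<in>pverts T - leaves T. 0 < c v"
    and "p \<in> world T c"
  shows "lattice_inv T c ls (lattice_map ls p) = p"
  unfolding lattice_inv_def
  using lattice_map_bij[OF assms(1-4)] assms(5) by (simp add: bij_betw_def the_inv_into_f_f)

lemma biray_eq_plane:
  assumes T: "tree_graph T" and ls: "distinct ls" "set ls = leaves T" "ls = x # y # zs"
    and c: "\<forall>v\<in>pverts T - leaves T. 0 < c v"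
    and a: "length a = length zs" "\<forall>k\<in>set a. 0 < k"
  obtains s where "position (T, s)"
    "\<And>m n. (m, n) \<noteq> (0, 0) \<Longrightarrow> biray T c ls a m n = plane T s x y m n"
proof -
  \<comment> \<open>The two entries 1 are arbitrary positive values, later overwritten by
    \<open>plane\<close>; the point only supplies the remaining sizes.\<close>
  have "1 # 1 # a \<in> lattice_map ls ` world T c"
    unfolding bij_betw_imp_surj_on[OF lattice_map_bij[OF T ls(1,2) c]]
    using a by (auto simp: ls(3) nth_Cons split: nat.splits) (metis nth_mem less_irrefl)+
  then obtain p where p: "p \<in> world T c" and map_p: "map (snd p) ls = 1 # 1 # a"
    by (auto simp: lattice_map_def)
  define s where "s = snd p"
  have map_s: "s x = 1" "s y = 1" "map s zs = a" using map_p by (auto simp: s_def ls(3))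
  have leaf: "0 < s v" if "v \<in> leaves T" for v
  proof -
    have "v = x \<or> v = y \<or> v \<in> set zs" using that ls(2,3) by auto
    then show ?thesis using map_s a(2) by auto
  qed
  have xyL: "x \<in> leaves T" "y \<in> leaves T" "x \<noteq> y" "x \<notin> set zs" "y \<notin> set zs" using ls by auto
  have s: "\<forall>v\<in>pverts T - leaves T. s v = c v \<and> 0 < c v" "\<forall>v. v \<notin> pverts T \<longrightarrow> s v = 0"
    using p unfolding world_iff[OF T] s_def by auto
  have pos: "position (T, s)"
    using s leaf T by (auto simp: position_def) (metis DiffI)
  have "biray T c ls a m n = plane T s x y m n" if mn: "(m, n) \<noteq> (0, 0)" for m n
  proof -
    have "plane T s x y m n \<in> world T c"
    proof -
      consider "m = 0" "0 < n" | "0 < m" "n = 0" | "0 < m" "0 < n" using mn by auto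
      then have "fst (plane T s x y m n) = T \<and> (\<forall>v\<in>leaves T. 0 < snd (plane T s x y m n) v) \<or>
          (\<exists>l\<in>leaves T. fst (plane T s x y m n) = del_vertex T l \<and>
             snd (plane T s x y m n) l = 0 \<and> (\<forall>v\<in>leaves T - {l}. 0 < snd (plane T s x y m n) v))"
      proof cases
        case 1
        then show ?thesis using leaf xyL
          by (intro disjI2 bexI[of _ x]) (auto simp: plane_def)
      next
        case 2
        then show ?thesis using leaf xyL
          by (intro disjI2 bexI[of _ y]) (auto simp: plane_def)
      next
        case 3
        then show ?thesis using leaf by (intro disjI1) (auto simp: plane_def)
      qed
      moreover have "snd (plane T s x y m n) v = s v" if "v \<notin> leaves T" for v
        using that xyL by (auto simp: plane_def)
      moreover have "v \<notin> leaves T" if "v \<notin> pverts T" for v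
        using that by (simp add: leaves_def)
      ultimately show ?thesis unfolding world_iff[OF T] using s by simp
    qed
    moreover have "lattice_map ls (plane T s x y m n) = m # n # a"
      using xyL map_s(3) by (auto simp: lattice_map_def plane_def ls(3))
    ultimately show ?thesis
      using lattice_inv_eq[OF T ls(1,2) c] by (metis biray_def)
  qed
  with pos show thesis by (rule that)
qed

theorem mainTheorem7:
  fixes T :: "'a pair_pre_digraph" and c :: "'a \<Rightarrow> nat"
    and ls :: "'a list" and d :: nat and a :: "nat list"
  assumes "tree_graph T"
    and "distinct ls" and "set ls = leaves T" and "length ls = d"
    and "\<forall>v\<in>pverts T - leaves T. 0 < c v"
    and "2 \<le> d"
    and "length a = d - 2" and "\<forall>x\<in>set a. 0 < x"
  shows "additively_periodic (completion_seq (biray T c ls a)) \<and>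
    (\<exists>N p. 1 \<le> p \<and> (\<forall>m n. N < m \<and> N < n \<longrightarrow>
       (P_position (biray T c ls a m n) \<longleftrightarrow> P_position (biray T c ls a (m + p) (n + p)))))"
proof -
  obtain x y zs where ls: "ls = x # y # zs"
    using assms(4,6) by (metis Suc_le_length_iff numeral_2_eq_2)
  have zs: "length a = length zs" using assms(4,7) ls by simp
  obtain s where pos: "position (T, s)"
    and eq: "\<And>m n. (m, n) \<noteq> (0, 0) \<Longrightarrow> biray T c ls a m n = plane T s x y m n"
    using biray_eq_plane[OF assms(1,2,3) ls assms(5) zs assms(8)] by blast
  have xy: "x \<in> leaves T" "y \<in> leaves T" "x \<noteq> y" using assms(2,3) ls by auto
  let ?A = "\<lambda>m n. P_position (plane T s x y m n)"
  have per: "diag_periodic ?A" "diag_periodic (blocked T s x y)"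
    using diag_periodic_plane_blocked[OF pos xy] by auto
  obtain N p where p: "1 \<le> p" and inv: "diag_invariant N p ?A"
    using per(1) by (auto simp: diag_periodic_def)
  obtain D where "banded D (blocked T s x y)" using per(2) by (auto simp: diag_periodic_def)
  then obtain M where "greedy_array ?A (blocked T s x y) D M"
    by (rule greedy_array_plane[OF pos xy])
  then have "additively_periodic (\<lambda>n. THE m. ?A m n)"
    using inv p by (rule greedy_array.additively_periodic_The)
  \<comment> \<open>For positive \<open>n\<close> every (\<open>m\<close>, \<open>n\<close>),
    including \<open>m = 0\<close>, differs from (0, 0), so \<open>THE\<close> ranges over the same
    cells.\<close>
  moreover have "completion_seq (biray T c ls a) n = (THE m. ?A m n)" if "0 < n" for n
    using that by (simp add: completion_seq_def eq)
  ultimately have "additively_periodic (completion_seq (biray T c ls a))"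
    by (auto simp: additively_periodic_def)
  moreover have "P_position (biray T c ls a m n) \<longleftrightarrow> P_position (biray T c ls a (m + p) (n + p))"
    if "N < m" "N < n" for m n
    using diag_invariantD[OF inv that] that by (simp add: eq)
  ultimately show ?thesis using p by blast
qed

end
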